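(* The $\mathbb{F}$-algebra $U^{\vee}_q$ has a presentation by generators $X,y^{-1},Z$ and relations $$\frac{qy^{-1}X-q^{-1}Xy^{-1}}{q-q^{-1}} = y^{-2},\qquad \frac{qZy^{-1}-q^{-1}y^{-1}Z}{q-q^{-1}} = y^{-2},\qquad \frac{qZX-q^{-1}XZ}{q-q^{-1}} = 1.$$
   Context: Algebras are associative with $1$, and a subalgebra has the same $1$ as the parent algebra. $\mathbb{F}$ is a field, $q\in\mathbb{F}$ is nonzero with $q^4\neq 1$, and $a\in\mathbb{F}$ is nonzero with $a^2\neq 1$. $U_q(\mathfrak{sl}_2)$ is the $\mathbb{F}$-algebra with generators $x,y^{\pm1},z$ and relations $yy^{-1}=y^{-1}y=1$, $$\frac{qxy-q^{-1}yx}{q-q^{-1}} = 1,\qquad \frac{qyz-q^{-1}zy}{q-q^{-1}} = 1,\qquad \frac{qzx-q^{-1}xz}{q-q^{-1}} = 1$$ (the equitable presentation). $U^\vee_q$ is the subalgebra of $U_q(\mathfrak{sl}_2)$ generated by $x,y^{-1},z$. The elements $X,Z\in U^\vee_q$ are $$X=a^{-2}x+(1-a^{-2})y^{-1},\qquad Z=a^2z+(1-a^2)y^{-1}.$$ In the claim, $y^{-1}$ is treated as a single generator symbol (not required to be invertible) and $y^{-2}=(y^{-1})^2$. *)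

theory Defs
  imports "HOL-Algebra.QuotRing" "HOL-Algebra.Subrings" "HOL-Library.Poly_Mapping"
begin

section \<open>Associative unital algebras over a field\<close>

text \<open>
  The ground field is a type of class \<open>field\<close>; algebras are records of type
  \<open>('f, 'a) module\<close>. The locale \<open>algebra\<close> of the library requires a commutative
  multiplication, hence the following noncommutative version.
\<close>

locale assoc_algebra = ring A for A :: "('f::field, 'a) module" (structure) +
  assumes smult_closed: "u \<in> carrier A \<Longrightarrow> c \<odot> u \<in> carrier A"
    and smult_l_distr: "u \<in> carrier A \<Longrightarrow> (c + d) \<odot> u = c \<odot> u \<oplus> d \<odot> u"
    and smult_r_distr: "u \<in> carrier A \<Longrightarrow> v \<in> carrier A \<Longrightarrow> c \<odot> (u \<oplus> v) = c \<odot> u \<oplus> c \<odot> v"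
    and smult_assoc: "u \<in> carrier A \<Longrightarrow> (c * d) \<odot> u = c \<odot> (d \<odot> u)"
    and smult_one: "u \<in> carrier A \<Longrightarrow> 1 \<odot> u = u"
    and smult_mult_left: "u \<in> carrier A \<Longrightarrow> v \<in> carrier A \<Longrightarrow> (c \<odot> u) \<otimes> v = c \<odot> (u \<otimes> v)"
    and smult_mult_right: "u \<in> carrier A \<Longrightarrow> v \<in> carrier A \<Longrightarrow> u \<otimes> (c \<odot> v) = c \<odot> (u \<otimes> v)"

definition alg_hom :: "('f::field, 'a) module \<Rightarrow> ('f, 'b) module \<Rightarrow> ('a \<Rightarrow> 'b) set" where
  "alg_hom A B = {h \<in> ring_hom A B. \<forall>c. \<forall>u \<in> carrier A. h (c \<odot>\<^bsub>A\<^esub> u) = c \<odot>\<^bsub>B\<^esub> h u}"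

definition alg_iso :: "('f::field, 'a) module \<Rightarrow> ('f, 'b) module \<Rightarrow> ('a \<Rightarrow> 'b) set" where
  "alg_iso A B = {h \<in> alg_hom A B. bij_betw h (carrier A) (carrier B)}"

definition subalg :: "'a set \<Rightarrow> ('f::field, 'a) module \<Rightarrow> bool" where
  "subalg V A \<longleftrightarrow> subring V A \<and> (\<forall>c. \<forall>v \<in> V. c \<odot>\<^bsub>A\<^esub> v \<in> V)"

definition generated_subalg :: "('f::field, 'a) module \<Rightarrow> 'a set \<Rightarrow> ('f, 'a) module" where
  "generated_subalg A S = A\<lparr>carrier := \<Inter>{V. subalg V A \<and> S \<subseteq> V}\<rparr>"

definition quot_alg :: "('f::field, 'a) module \<Rightarrow> 'a set \<Rightarrow> ('f, 'a set) module" where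
  "quot_alg A I = ring.extend (A Quot I)
     (module.fields (\<lambda>c C. \<Union>u \<in> C. I +>\<^bsub>A\<^esub> (c \<odot>\<^bsub>A\<^esub> u)))"


section \<open>Free algebras and presentations\<close>

text \<open>
  The free algebra on \<open>'g\<close> is the monoid algebra of the free monoid on \<open>'g\<close>. The monoid is
  written additively because the convolution product of \<open>'w \<Rightarrow>\<^sub>0 'f\<close> is defined for
  \<open>'w :: monoid_add\<close>, a class that does not require commutativity.
\<close>

datatype 'g word = Word "'g list"

instantiation word :: (type) monoid_add
begin

definition zero_word :: "'a word" where "zero_word = Word []"

fun plus_word :: "'a word \<Rightarrow> 'a word \<Rightarrow> 'a word" where
  "plus_word (Word u) (Word v) = Word (u @ v)"

instance
proof
  fix a b c :: "'a word"
  show "a + b + c = a + (b + c)" by (cases a; cases b; cases c) simp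
  show "0 + a = a" by (cases a) (simp add: zero_word_def)
  show "a + 0 = a" by (cases a) (simp add: zero_word_def)
qed

end

type_synonym ('g, 'f) free_alg = "'g word \<Rightarrow>\<^sub>0 'f"

definition var :: "'g \<Rightarrow> ('g, 'f::field) free_alg" where
  "var g = Poly_Mapping.single (Word [g]) 1"

definition scale :: "'f::field \<Rightarrow> ('g, 'f) free_alg \<Rightarrow> ('g, 'f) free_alg" where
  "scale c p = Poly_Mapping.single 0 c * p"

definition free_algebra :: "('f::field, ('g, 'f) free_alg) module" where
  "free_algebra = \<lparr>carrier = UNIV, monoid.mult = (*), one = 1, zero = 0, add = (+), smult = scale\<rparr>"

text \<open>A pair \<open>(l, r)\<close> stands for the relation \<open>l = r\<close>; ideals in the library are two-sided.\<close>

type_synonym ('g, 'f) relations = "(('g, 'f) free_alg \<times> ('g, 'f) free_alg) set"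

definition relation_ideal :: "('g, 'f::field) relations \<Rightarrow> ('g, 'f) free_alg set" where
  "relation_ideal R = Idl\<^bsub>free_algebra\<^esub> {l - r | l r. (l, r) \<in> R}"

definition presented_algebra :: "('g, 'f::field) relations \<Rightarrow> ('f, ('g, 'f) free_alg set) module" where
  "presented_algebra R = quot_alg free_algebra (relation_ideal R)"

definition presented_gen :: "('g, 'f::field) relations \<Rightarrow> 'g \<Rightarrow> ('g, 'f) free_alg set" where
  "presented_gen R g = relation_ideal R +>\<^bsub>free_algebra\<^esub> var g"

definition has_presentation ::
  "('f::field, 'a) module \<Rightarrow> ('g \<Rightarrow> 'a) \<Rightarrow> ('g, 'f) relations \<Rightarrow> bool" where
  "has_presentation A \<gamma> R \<longleftrightarrow>
     assoc_algebra A \<and>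
     (\<exists>h \<in> alg_iso (presented_algebra R) A. \<forall>g. h (presented_gen R g) = \<gamma> g)"


section \<open>The equitable presentation and the subalgebra generated by \<open>x, y\<^sup>-\<^sup>1, z\<close>\<close>

definition q_bracket :: "'f::field \<Rightarrow> ('g, 'f) free_alg \<Rightarrow> ('g, 'f) free_alg \<Rightarrow> ('g, 'f) free_alg" where
  "q_bracket q u v = scale (1 / (q - inverse q)) (scale q (u * v) - scale (inverse q) (v * u))"

datatype Uq_gen = U_x | U_y | U_yinv | U_z

definition Uq_relations :: "'f::field \<Rightarrow> (Uq_gen, 'f) relations" where
  "Uq_relations q =
    {(var U_y * var U_yinv, 1),
     (var U_yinv * var U_y, 1),
     (q_bracket q (var U_x) (var U_y), 1),
     (q_bracket q (var U_y) (var U_z), 1),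
     (q_bracket q (var U_z) (var U_x), 1)}"

definition Uq :: "'f::field \<Rightarrow> ('f, (Uq_gen, 'f) free_alg set) module" where
  "Uq q = presented_algebra (Uq_relations q)"

definition Uq_elem :: "'f::field \<Rightarrow> Uq_gen \<Rightarrow> (Uq_gen, 'f) free_alg set" where
  "Uq_elem q = presented_gen (Uq_relations q)"

definition Uq_vee :: "'f::field \<Rightarrow> ('f, (Uq_gen, 'f) free_alg set) module" where
  "Uq_vee q = generated_subalg (Uq q) {Uq_elem q U_x, Uq_elem q U_yinv, Uq_elem q U_z}"

definition X_elem :: "'f::field \<Rightarrow> 'f \<Rightarrow> (Uq_gen, 'f) free_alg set" where
  "X_elem q a = (inverse (a\<^sup>2) \<odot>\<^bsub>Uq q\<^esub> Uq_elem q U_x)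
     \<oplus>\<^bsub>Uq q\<^esub> ((1 - inverse (a\<^sup>2)) \<odot>\<^bsub>Uq q\<^esub> Uq_elem q U_yinv)"

definition Z_elem :: "'f::field \<Rightarrow> 'f \<Rightarrow> (Uq_gen, 'f) free_alg set" where
  "Z_elem q a = (a\<^sup>2 \<odot>\<^bsub>Uq q\<^esub> Uq_elem q U_z)
     \<oplus>\<^bsub>Uq q\<^esub> ((1 - a\<^sup>2) \<odot>\<^bsub>Uq q\<^esub> Uq_elem q U_yinv)"

datatype vee_gen = V_X | V_yinv | V_Z

definition vee_relations :: "'f::field \<Rightarrow> (vee_gen, 'f) relations" where
  "vee_relations q =
    {(q_bracket q (var V_yinv) (var V_X), (var V_yinv)\<^sup>2),
     (q_bracket q (var V_Z) (var V_yinv), (var V_yinv)\<^sup>2),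
     (q_bracket q (var V_Z) (var V_X), 1)}"

fun vee_elem :: "'f::field \<Rightarrow> 'f \<Rightarrow> vee_gen \<Rightarrow> (Uq_gen, 'f) free_alg set" where
  "vee_elem q a V_X = X_elem q a"
| "vee_elem q a V_yinv = Uq_elem q U_yinv"
| "vee_elem q a V_Z = Z_elem q a"

end

theory Submission
  imports Defs
begin

text \<open>
  Write \<open>w = y\<^sup>-\<^sup>1\<close>, \<open>e = x - w\<close>, \<open>f = z - w\<close> and \<open>s = q\<^sup>-\<^sup>2\<close>. The relations of \<open>U\<^sub>q\<close> imply
  \<open>w e = s e w\<close>, \<open>f w = s w f\<close> and \<open>f e = s e f + (1 - s) (1 - w\<^sup>2)\<close>, and in the algebra \<open>V\<close>
  presented by the relations of the theorem the elements \<open>a\<^sup>2 (X - w)\<close>, \<open>w\<close>, \<open>a\<^sup>-\<^sup>2 (Z - w)\<close> satisfy the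
  same three relations. These formulas define an action of \<open>U\<^sub>q\<close> on the free module \<open>M\<close> with basis the
  symbols \<open>e\<^sup>i w\<^sup>j f\<^sup>k\<close>, where \<open>i, k \<ge> 0\<close> and \<open>j\<close> is any integer. Reading the symbols with \<open>j \<ge> 0\<close> as
  products in \<open>V\<close> intertwines the action of \<open>V\<close> through \<open>U\<^sub>q\<close> with left multiplication, and it sends
  \<open>p \<cdot> 1\<close> to \<open>p\<close>. Hence an element of \<open>V\<close> that vanishes in \<open>U\<^sub>q\<close> is zero.
\<close>

section \<open>Linear maps on free modules\<close>

text \<open>\<open>scale\<close> multiplies by a constant of a free algebra. This version works for
  every index type, so that free algebras and the module of PBW symbols share one vector space
  structure.\<close>

definition pm_scale :: "'f::field \<Rightarrow> ('b \<Rightarrow>\<^sub>0 'f) \<Rightarrow> ('b \<Rightarrow>\<^sub>0 'f)" where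
  "pm_scale c m = Poly_Mapping.map ((*) c) m"

lemma lookup_pm_scale [simp]: "Poly_Mapping.lookup (pm_scale c m) b = c * Poly_Mapping.lookup m b"
  by (simp add: pm_scale_def map.rep_eq when_def)

lemma scale_eq_pm_scale: "scale = pm_scale"
  by (intro ext) (simp add: scale_def pm_scale_def mult_map_scale_conv_mult)

lemma linear_mapI:
  assumes "vector_space s1" "vector_space s2"
    and "\<And>u v. f (u + v) = f u + f v" "\<And>c u. f (s1 c u) = s2 c (f u)"
  shows "Vector_Spaces.linear s1 s2 f"
  using assms
  by (simp add: Vector_Spaces.linear_def module_hom_def module_hom_axioms_def module_iff_vector_space)

interpretation pm: vector_space pm_scale
  by unfold_locales (auto intro!: poly_mapping_eqI simp: lookup_add algebra_simps)

lemma pm_scale_single [simp]: "pm_scale c (Poly_Mapping.single b d) = Poly_Mapping.single b (c * d)"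
  by (rule poly_mapping_eqI) (simp add: lookup_single when_def)

lemma poly_mapping_eq_sum_single:
  "m = (\<Sum>b\<in>Poly_Mapping.keys m. pm_scale (Poly_Mapping.lookup m b) (Poly_Mapping.single b 1))"
  by (rule poly_mapping_eqI) (simp add: lookup_sum lookup_single when_def in_keys_iff sum.delta)

\<comment> \<open>A locale of its own, since \<open>vector_space\<close> has a global interpretation whose qualifier is
  optional, which would capture the names defined here.\<close>
locale linear_extension = vector_space scale
  for scale :: "'a::field \<Rightarrow> 'b::ab_group_add \<Rightarrow> 'b" (infixr \<open>*s\<close> 75)
begin

definition lin_ext :: "('c \<Rightarrow> 'b) \<Rightarrow> ('c \<Rightarrow>\<^sub>0 'a) \<Rightarrow> 'b" where
  "lin_ext f m = (\<Sum>b\<in>Poly_Mapping.keys m. Poly_Mapping.lookup m b *s f b)"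

lemma lin_ext_superset:
  fixes m :: "'c \<Rightarrow>\<^sub>0 'a"
  assumes "finite A" "Poly_Mapping.keys m \<subseteq> A"
  shows "lin_ext f m = (\<Sum>b\<in>A. Poly_Mapping.lookup m b *s f b)"
  unfolding lin_ext_def
  by (rule sum.mono_neutral_left) (use assms in \<open>auto simp: in_keys_iff\<close>)

lemma linear_lin_ext: "Vector_Spaces.linear pm_scale scale (lin_ext f)"
proof (rule linear_mapI)
  fix m n :: "'c \<Rightarrow>\<^sub>0 'a" and c
  let ?A = "Poly_Mapping.keys m \<union> Poly_Mapping.keys n"
  have "lin_ext f (m + n) = (\<Sum>b\<in>?A. Poly_Mapping.lookup (m + n) b *s f b)"
    by (rule lin_ext_superset) (auto simp: Poly_Mapping.keys_add)
  also have "\<dots> = (\<Sum>b\<in>?A. Poly_Mapping.lookup m b *s f b) + (\<Sum>b\<in>?A. Poly_Mapping.lookup n b *s f b)"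
    by (simp add: lookup_add scale_left_distrib sum.distrib)
  also have "\<dots> = lin_ext f m + lin_ext f n"
    by (simp add: lin_ext_superset[of ?A])
  finally show "lin_ext f (m + n) = lin_ext f m + lin_ext f n" .
  have "lin_ext f (pm_scale c m) = (\<Sum>b\<in>Poly_Mapping.keys m. Poly_Mapping.lookup (pm_scale c m) b *s f b)"
    by (rule lin_ext_superset) (auto simp: in_keys_iff)
  then show "lin_ext f (pm_scale c m) = c *s lin_ext f m"
    by (simp add: lin_ext_def scale_sum_right)
qed unfold_locales

lemma lin_ext_single [simp]: "lin_ext f (Poly_Mapping.single b c) = c *s f b"
  by (simp add: lin_ext_def)

lemma linear_eqI_single:
  assumes f: "Vector_Spaces.linear pm_scale scale f" and g: "Vector_Spaces.linear pm_scale scale g"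
    and eq: "\<And>b. f (Poly_Mapping.single b 1) = g (Poly_Mapping.single b 1)"
  shows "f m = g m"
proof -
  have *: "h m = (\<Sum>b\<in>Poly_Mapping.keys m. Poly_Mapping.lookup m b *s h (Poly_Mapping.single b 1))"
    if "Vector_Spaces.linear pm_scale scale h" for h
  proof -
    interpret h: Vector_Spaces.linear pm_scale scale h by (fact that)
    show ?thesis
      by (subst poly_mapping_eq_sum_single[of m]) (simp add: h.sum h.scale del: pm_scale_single)
  qed
  show ?thesis
    by (simp add: *[OF f] *[OF g] eq)
qed

end

interpretation pm: linear_extension pm_scale
  by unfold_locales

section \<open>Actions of free algebras\<close>

lemma scale_one_left [simp]: "scale 1 p = p"
  by (simp add: scale_eq_pm_scale)

lemma scale_add_left: "scale (c + d) p = scale c p + scale d p"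
  and scale_add_right: "scale c (p + r) = scale c p + scale c r"
  and scale_mult: "scale (c * d) p = scale c (scale d p)"
  by (simp_all add: scale_eq_pm_scale pm.scale_left_distrib pm.scale_right_distrib)

lemma scale_mult_left: "scale c p * r = scale c (p * r)"
  by (simp add: scale_def mult.assoc)


lemma single_zero_commute:
  fixes p :: "('g, 'f::field) free_alg"
  shows "Poly_Mapping.single 0 c * p = p * Poly_Mapping.single 0 c"
  by (subst (1 2) poly_mapping_eq_sum_single[of p])
    (simp add: sum_distrib_left sum_distrib_right mult_single mult.commute)

lemma scale_mult_right: "p * scale c r = scale c (p * r)"
  unfolding scale_def by (metis mult.assoc single_zero_commute)

lemma linear_mult_left: "Vector_Spaces.linear pm_scale pm_scale (\<lambda>p :: ('g, 'f::field) free_alg. u * p)"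
  by (rule linear_mapI[OF pm.vector_space_axioms pm.vector_space_axioms])
    (simp_all add: distrib_left scale_mult_right flip: scale_eq_pm_scale)

lemma single_word_Cons:
  "Poly_Mapping.single (Word (g # l)) 1 = var g * Poly_Mapping.single (Word l) 1"
  by (simp add: var_def mult_single)

text \<open>Elements are linear combinations of words, and a word arises from the empty one by
  putting letters in front, which is left multiplication by generators.\<close>

lemma free_alg_induct [case_names one add scale var_mult]:
  fixes p :: "('g, 'f::field) free_alg"
  assumes one: "P 1"
    and add: "\<And>p r. P p \<Longrightarrow> P r \<Longrightarrow> P (p + r)"
    and scale: "\<And>c p. P p \<Longrightarrow> P (scale c p)"
    and var_mult: "\<And>g p. P p \<Longrightarrow> P (var g * p)"
  shows "P p"
proof -
  have word: "P (Poly_Mapping.single (Word l) 1)" for l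
  proof (induction l)
    case Nil
    then show ?case using one by (simp add: single_one flip: zero_word_def)
  next
    case (Cons g l)
    then show ?case by (simp add: single_word_Cons var_mult)
  qed
  have zero: "P 0"
    using scale[OF one, of 0] by (simp add: scale_def)
  have "P (\<Sum>b\<in>A. pm_scale (Poly_Mapping.lookup p b) (Poly_Mapping.single b 1))"
    if "finite A" for A
    using that
  proof induction
    case (insert b A)
    have "P (scale (Poly_Mapping.lookup p b) (Poly_Mapping.single b 1))"
      by (intro scale) (cases b, simp add: word)
    with insert show ?case by (simp add: add scale_eq_pm_scale)
  qed (simp add: zero)
  from this[of "Poly_Mapping.keys p"] show ?thesis
    by (simp only: poly_mapping_eq_sum_single[symmetric] finite_keys)
qed

locale free_action = linear_extension scale
  for scale :: "'f::field \<Rightarrow> 'v::ab_group_add \<Rightarrow> 'v" (infixr \<open>*s\<close> 75) +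
  fixes ops :: "'g \<Rightarrow> 'v \<Rightarrow> 'v"
  assumes linear_ops: "Vector_Spaces.linear (*s) (*s) (ops g)"
begin

sublocale ops: Vector_Spaces.linear "(*s)" "(*s)" "ops g" for g
  by (rule linear_ops)

text \<open>\<open>foldr\<close> lets the last letter act first, so that concatenation becomes
  composition and \<open>act\<close> a left module structure.\<close>

fun word_act :: "'g word \<Rightarrow> 'v \<Rightarrow> 'v" where
  "word_act (Word l) v = foldr ops l v"

definition act :: "('g, 'f) free_alg \<Rightarrow> 'v \<Rightarrow> 'v" where
  "act p v = lin_ext (\<lambda>w. word_act w v) p"

lemma linear_act_left: "Vector_Spaces.linear pm_scale (*s) (\<lambda>p. act p v)"
  unfolding act_def by (rule linear_lin_ext)

sublocale act_left: Vector_Spaces.linear pm_scale "(*s)" "\<lambda>p. act p v" for v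
  by (rule linear_act_left)

lemmas act_add_left = act_left.add and act_diff_left = act_left.diff and act_zero_left = act_left.zero

lemma act_scale_left: "act (Defs.scale c p) v = c *s act p v"
  by (simp add: scale_eq_pm_scale act_left.scale)

lemma act_single_word: "act (Poly_Mapping.single w c) v = c *s word_act w v"
  by (simp add: act_def)

lemma act_one [simp]: "act 1 v = v"
proof -
  have *: "(1 :: ('g, 'f) free_alg) = Poly_Mapping.single (Word []) 1"
    by (simp flip: zero_word_def)
  show ?thesis by (subst *) (simp add: act_single_word)
qed

text \<open>Both sides are linear in \<open>p\<close>, and on a word the claim is the recursion of
  \<open>foldr\<close>.\<close>

lemma act_var_mult [simp]: "act (var g * p) v = ops g (act p v)"
proof (rule linear_eqI_single)
  show "Vector_Spaces.linear pm_scale (*s) (\<lambda>p. act (var g * p) v)"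
    using Vector_Spaces.linear_compose[OF linear_mult_left linear_act_left] by (simp add: o_def)
  show "Vector_Spaces.linear pm_scale (*s) (\<lambda>p. ops g (act p v))"
    using Vector_Spaces.linear_compose[OF linear_act_left linear_ops] by (simp add: o_def)
  fix b :: "'g word"
  show "act (var g * Poly_Mapping.single b 1) v = ops g (act (Poly_Mapping.single b 1) v)"
    by (cases b) (simp flip: single_word_Cons add: act_single_word)
qed

lemma act_var [simp]: "act (var g) v = ops g v"
  using act_var_mult[of g 1 v] by simp

lemma act_mult: "act (p * r) v = act p (act r v)"
  by (induction p rule: free_alg_induct)
    (simp_all add: distrib_right scale_mult_left act_add_left act_scale_left mult.assoc)

lemma linear_act: "Vector_Spaces.linear (*s) (*s) (act p)"
proof (rule linear_mapI)
  show "act p (u + v) = act p u + act p v" for u v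
    by (induction p rule: free_alg_induct)
      (simp_all add: act_add_left act_scale_left ops.add scale_right_distrib algebra_simps)
  show "act p (c *s u) = c *s act p u" for c u
    by (induction p rule: free_alg_induct)
      (simp_all add: act_add_left act_scale_left ops.scale scale_right_distrib mult.commute)
qed unfold_locales

end

section \<open>Substitution homomorphisms between free algebras\<close>

locale free_alg_subst =
  fixes \<theta> :: "'g \<Rightarrow> ('h, 'f::field) free_alg"
begin

sublocale left_mult: free_action "pm_scale :: 'f \<Rightarrow> ('h, 'f) free_alg \<Rightarrow> _" "\<lambda>g p. \<theta> g * p"
  by (intro free_action.intro free_action_axioms.intro linear_mult_left pm.linear_extension_axioms)

text \<open>When each generator acts as left multiplication by its image, the substitution
  homomorphism is the orbit map of 1, so its linearity is inherited from the action.\<close>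

definition subst :: "('g, 'f) free_alg \<Rightarrow> ('h, 'f) free_alg" where
  "subst p = left_mult.act p 1"

lemma subst_add: "subst (p + r) = subst p + subst r"
  and subst_diff: "subst (p - r) = subst p - subst r"
  and subst_scale: "subst (scale c p) = scale c (subst p)"
  and subst_zero [simp]: "subst 0 = 0"
  and subst_one [simp]: "subst 1 = 1"
  and subst_var [simp]: "subst (var g) = \<theta> g"
  and subst_var_mult: "subst (var g * p) = \<theta> g * subst p"
  by (simp_all add: subst_def left_mult.act_add_left left_mult.act_diff_left
      left_mult.act_zero_left left_mult.act_scale_left, simp add: scale_eq_pm_scale)

lemma subst_mult: "subst (p * r) = subst p * subst r"
  by (induction p rule: free_alg_induct)
    (simp_all add: distrib_right scale_mult_left subst_add subst_scale subst_var_mult mult.assoc)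

end

section \<open>Presented algebras\<close>

lemma ring_free_algebra: "ring (free_algebra :: ('f::field, ('g, 'f) free_alg) module)"
proof (intro ringI abelian_groupI monoidI)
  fix x :: "('g, 'f) free_alg"
  show "\<exists>y\<in>carrier free_algebra. y \<oplus>\<^bsub>free_algebra\<^esub> x = \<zero>\<^bsub>free_algebra\<^esub>"
    by (rule bexI[of _ "- x"]) (simp_all add: free_algebra_def)
qed (simp_all add: free_algebra_def algebra_simps)

lemma ideal_free_algebraI:
  fixes J :: "('g, 'f::field) free_alg set"
  assumes zero: "0 \<in> J" and add: "\<And>p r. p \<in> J \<Longrightarrow> r \<in> J \<Longrightarrow> p + r \<in> J"
    and mult_left: "\<And>u p. p \<in> J \<Longrightarrow> u * p \<in> J" and mult_right: "\<And>u p. p \<in> J \<Longrightarrow> p * u \<in> J"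
  shows "ideal J (free_algebra :: ('f, _) module)"
proof (rule idealI[OF ring_free_algebra])
  interpret ring "free_algebra :: ('f, ('g, 'f) free_alg) module"
    by (rule ring_free_algebra)
  have neg: "\<ominus>\<^bsub>free_algebra\<^esub> p = - p" for p :: "('g, 'f) free_alg"
    by (rule minus_equality) (simp_all add: free_algebra_def)
  show "subgroup J (add_monoid (free_algebra :: ('f, _) module))"
  proof (rule add.subgroupI)
    fix p assume "p \<in> J"
    from mult_left[OF this, of "- 1"] show "\<ominus>\<^bsub>free_algebra\<^esub> p \<in> J" by (simp add: neg)
  qed (use zero add in \<open>auto simp: free_algebra_def\<close>)
qed (auto simp: free_algebra_def mult_left mult_right)

lemma ideal_relation_ideal: "ideal (relation_ideal R) free_algebra"
  unfolding relation_ideal_def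
  by (rule ring.genideal_ideal[OF ring_free_algebra]) (simp add: free_algebra_def)

text \<open>The closure assumptions make the set of all \<open>p\<close> with \<open>P p\<close> an
  ideal that contains every \<open>l - r\<close>; minimality of the generated ideal does the
  rest.\<close>

lemma relation_ideal_induct [consumes 1, case_names relation zero add mult_left mult_right]:
  assumes p: "p \<in> relation_ideal R"
    and relation: "\<And>l r. (l, r) \<in> R \<Longrightarrow> P (l - r)"
    and zero: "P 0" and add: "\<And>p r. P p \<Longrightarrow> P r \<Longrightarrow> P (p + r)"
    and mult_left: "\<And>u p. P p \<Longrightarrow> P (u * p)" and mult_right: "\<And>u p. P p \<Longrightarrow> P (p * u)"
  shows "P p"
proof -
  have "relation_ideal R \<subseteq> {p. P p}"
    unfolding relation_ideal_def
    by (rule ring.genideal_minimal[OF ring_free_algebra ideal_free_algebraI])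
      (auto intro: assms)
  with p show ?thesis by auto
qed

lemma relation_ideal_relation: "(l, r) \<in> R \<Longrightarrow> l - r \<in> relation_ideal R"
  unfolding relation_ideal_def
  using ring.genideal_self[OF ring_free_algebra, of "{l - r | l r. (l, r) \<in> R}"]
  by (auto simp: free_algebra_def)

lemma
  fixes R :: "('g, 'f::field) relations"
  shows relation_ideal_zero [simp]: "0 \<in> relation_ideal R"
  and relation_ideal_add: "p \<in> relation_ideal R \<Longrightarrow> r \<in> relation_ideal R \<Longrightarrow> p + r \<in> relation_ideal R"
  and relation_ideal_mult_left: "p \<in> relation_ideal R \<Longrightarrow> u * p \<in> relation_ideal R"
  and relation_ideal_mult_right: "p \<in> relation_ideal R \<Longrightarrow> p * u \<in> relation_ideal R"
proof -
  interpret ideal "relation_ideal R" "free_algebra :: ('f, ('g, 'f) free_alg) module"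
    by (rule ideal_relation_ideal)
  show "0 \<in> relation_ideal R"
    using additive_subgroup.zero_closed[OF is_additive_subgroup] by (simp add: free_algebra_def)
  show "p \<in> relation_ideal R \<Longrightarrow> r \<in> relation_ideal R \<Longrightarrow> p + r \<in> relation_ideal R"
    using additive_subgroup.a_closed[OF is_additive_subgroup, of p r] by (simp add: free_algebra_def)
  show "p \<in> relation_ideal R \<Longrightarrow> u * p \<in> relation_ideal R"
    using I_l_closed[of p u] by (simp add: free_algebra_def)
  show "p \<in> relation_ideal R \<Longrightarrow> p * u \<in> relation_ideal R"
    using I_r_closed[of p u] by (simp add: free_algebra_def)
qed

lemma relation_ideal_scale: "p \<in> relation_ideal R \<Longrightarrow> scale c p \<in> relation_ideal R"
  unfolding scale_def by (rule relation_ideal_mult_left)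


lemma relation_ideal_minus: "p \<in> relation_ideal R \<Longrightarrow> - p \<in> relation_ideal R"
  using relation_ideal_mult_left[of p R "- 1"] by simp

lemma relation_ideal_diff:
  "p \<in> relation_ideal R \<Longrightarrow> r \<in> relation_ideal R \<Longrightarrow> p - r \<in> relation_ideal R"
  using relation_ideal_add[of p R "- r"] by (simp add: relation_ideal_minus)

section \<open>Residue classes and the operations on them\<close>

abbreviation cls :: "('g, 'f::field) relations \<Rightarrow> ('g, 'f) free_alg \<Rightarrow> ('g, 'f) free_alg set" where
  "cls R u \<equiv> relation_ideal R +>\<^bsub>free_algebra\<^esub> u"

lemma mem_cls: "v \<in> cls R u \<longleftrightarrow> v - u \<in> relation_ideal R"
proof -
  have "v \<in> cls R u \<longleftrightarrow> (\<exists>h\<in>relation_ideal R. v = h + u)"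
    by (auto simp: a_r_coset_def' free_algebra_def)
  then show ?thesis
    by (metis add_diff_cancel diff_add_cancel)
qed

lemma cls_eq_iff: "cls R u = cls R v \<longleftrightarrow> u - v \<in> relation_ideal R"
proof
  assume "cls R u = cls R v"
  then have "u \<in> cls R v"
    using mem_cls[of u R u] by simp
  then show "u - v \<in> relation_ideal R" by (simp add: mem_cls)
next
  assume uv: "u - v \<in> relation_ideal R"
  have "w - u \<in> relation_ideal R \<longleftrightarrow> w - v \<in> relation_ideal R" for w
    using relation_ideal_add[OF _ uv, of "w - u"] relation_ideal_diff[OF _ uv, of "w - v"] by auto
  then show "cls R u = cls R v"
    by (simp add: set_eq_iff mem_cls)
qed

lemma carrier_presented: "carrier (presented_algebra R) = range (cls R)"
  by (auto simp: presented_algebra_def quot_alg_def ring.extend_def module.fields_def FactRing_def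
      A_RCOSETS_def' free_algebra_def)

lemma
  fixes R :: "('g, 'f::field) relations"
  shows mult_presented: "cls R u \<otimes>\<^bsub>presented_algebra R\<^esub> cls R v = cls R (u * v)"
    and add_presented: "cls R u \<oplus>\<^bsub>presented_algebra R\<^esub> cls R v = cls R (u + v)"
    and one_presented: "\<one>\<^bsub>presented_algebra R\<^esub> = cls R 1"
    and zero_presented: "\<zero>\<^bsub>presented_algebra R\<^esub> = cls R 0"
proof -
  interpret ideal "relation_ideal R" "free_algebra :: ('f, ('g, 'f) free_alg) module"
    by (rule ideal_relation_ideal)
  show "cls R u \<otimes>\<^bsub>presented_algebra R\<^esub> cls R v = cls R (u * v)"
    using rcoset_mult_add[of u v]
    by (simp add: presented_algebra_def quot_alg_def ring.extend_def FactRing_def) (simp add: free_algebra_def)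
  show "cls R u \<oplus>\<^bsub>presented_algebra R\<^esub> cls R v = cls R (u + v)"
    using a_rcos_sum[of u v]
    by (simp add: presented_algebra_def quot_alg_def ring.extend_def FactRing_def) (simp add: free_algebra_def)
  show "\<one>\<^bsub>presented_algebra R\<^esub> = cls R 1"
    by (simp add: presented_algebra_def quot_alg_def ring.extend_def FactRing_def) (simp add: free_algebra_def)
  show "\<zero>\<^bsub>presented_algebra R\<^esub> = cls R 0"
    by (simp add: presented_algebra_def quot_alg_def ring.extend_def FactRing_def set_eq_iff mem_cls)
qed

text \<open>\<open>quot_alg\<close> forms a union over all representatives of a class. It collapses
  to one coset because scaling preserves the ideal.\<close>

lemma smult_presented: "c \<odot>\<^bsub>presented_algebra R\<^esub> cls R u = cls R (scale c u)"
proof -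
  have "cls R (scale c v) = cls R (scale c u)" if "v \<in> cls R u" for v
    using relation_ideal_scale[of "v - u" R c] that
    by (simp add: mem_cls cls_eq_iff scale_eq_pm_scale pm.scale_right_diff_distrib)
  moreover have "u \<in> cls R u" by (simp add: mem_cls)
  ultimately have "(\<Union>v\<in>cls R u. cls R (scale c v)) = cls R (scale c u)" by blast
  then show ?thesis
    by (simp add: presented_algebra_def quot_alg_def ring.extend_def module.fields_def)
      (simp add: free_algebra_def)
qed

lemmas presented_simps =
  carrier_presented mult_presented add_presented one_presented zero_presented smult_presented

lemma assoc_algebra_presented: "assoc_algebra (presented_algebra R)"
proof (intro assoc_algebra.intro ringI abelian_groupI monoidI assoc_algebra_axioms.intro)
  fix x assume "x \<in> carrier (presented_algebra R)"
  then obtain u where "x = cls R u" by (auto simp: carrier_presented)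
  then show "\<exists>y\<in>carrier (presented_algebra R). y \<oplus>\<^bsub>presented_algebra R\<^esub> x = \<zero>\<^bsub>presented_algebra R\<^esub>"
    by (intro bexI[of _ "cls R (- u)"]) (simp_all add: presented_simps)
qed (auto simp: presented_simps scale_add_left scale_add_right scale_mult scale_mult_left
    scale_mult_right ac_simps distrib_left distrib_right)

section \<open>Subalgebras of presented algebras\<close>

lemma (in assoc_algebra) assoc_algebra_subalg:
  assumes "subalg V A"
  shows "assoc_algebra (A\<lparr>carrier := V\<rparr>)"
proof -
  have V: "subring V A" "\<And>c v. v \<in> V \<Longrightarrow> c \<odot> v \<in> V"
    using assms by (auto simp: subalg_def)
  have "V \<subseteq> carrier A" using subringE(1)[OF V(1)] .
  then show ?thesis
    by (intro assoc_algebra.intro assoc_algebra_axioms.intro subring_is_ring[OF V(1)])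
      (auto simp: V(2) smult_l_distr smult_r_distr smult_assoc smult_one smult_mult_left
        smult_mult_right subset_iff)
qed

lemma subalg_presentedI:
  assumes sub: "V \<subseteq> carrier (presented_algebra R)" and one: "cls R 1 \<in> V"
    and add: "\<And>u v. cls R u \<in> V \<Longrightarrow> cls R v \<in> V \<Longrightarrow> cls R (u + v) \<in> V"
    and mult: "\<And>u v. cls R u \<in> V \<Longrightarrow> cls R v \<in> V \<Longrightarrow> cls R (u * v) \<in> V"
    and scale: "\<And>c u. cls R u \<in> V \<Longrightarrow> cls R (scale c u) \<in> V"
  shows "subalg V (presented_algebra R)"
proof -
  interpret assoc_algebra "presented_algebra R" by (rule assoc_algebra_presented)
  have V: "\<exists>u. v = cls R u" if "v \<in> V" for v
    using sub that by (auto simp: carrier_presented)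
  \<comment> \<open>Negatives are multiples by -1, so closure under scaling covers them.\<close>
  have neg: "\<ominus>\<^bsub>presented_algebra R\<^esub> cls R u = cls R (scale (-1) u)" for u
    by (rule minus_equality) (auto simp: presented_simps scale_eq_pm_scale)
  have "subring V (presented_algebra R)"
  proof (rule subringI)
    fix x y assume xy: "x \<in> V" "y \<in> V"
    then obtain u v where "x = cls R u" "y = cls R v" using V by blast
    with xy show "\<ominus>\<^bsub>presented_algebra R\<^esub> x \<in> V"
      "x \<otimes>\<^bsub>presented_algebra R\<^esub> y \<in> V" "x \<oplus>\<^bsub>presented_algebra R\<^esub> y \<in> V"
      by (simp_all add: neg scale presented_simps mult add)
  qed (use sub one in \<open>simp_all add: presented_simps\<close>)
  moreover have "c \<odot>\<^bsub>presented_algebra R\<^esub> v \<in> V" if "v \<in> V" for c v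
    using V[OF that] that by (auto simp: smult_presented intro: scale)
  ultimately show ?thesis
    by (simp add: subalg_def)
qed

lemma subalg_presentedD:
  assumes "subalg V (presented_algebra R)"
  shows "cls R 1 \<in> V" "cls R u \<in> V \<Longrightarrow> cls R v \<in> V \<Longrightarrow> cls R (u + v) \<in> V"
    "cls R u \<in> V \<Longrightarrow> cls R v \<in> V \<Longrightarrow> cls R (u * v) \<in> V"
    "cls R u \<in> V \<Longrightarrow> cls R (scale c u) \<in> V"
  using assms subringE(3,6,7)[of V "presented_algebra R"]
  by (auto simp: subalg_def simp flip: presented_simps(2-))

section \<open>A criterion for presentations of generated subalgebras\<close>

context free_alg_subst
begin

lemma subst_relation_ideal:
  assumes "\<And>l r. (l, r) \<in> R' \<Longrightarrow> subst l - subst r \<in> relation_ideal R"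
    and "p \<in> relation_ideal R'"
  shows "subst p \<in> relation_ideal R"
  using assms(2)
  by (induction rule: relation_ideal_induct)
    (simp_all add: assms(1) subst_diff subst_add subst_mult relation_ideal_add
      relation_ideal_mult_left relation_ideal_mult_right)

text \<open>The two directions of \<open>ideal\<close> make the map induced by \<open>subst\<close>
  on classes well defined and injective. Its image contains \<open>S\<close> by assumption
  \<open>S\<close>, and by \<open>gen\<close> it lies in every subalgebra containing
  \<open>S\<close>; hence it is the generated subalgebra.\<close>

lemma has_presentation_generated_subalg:
  fixes R :: "('h, 'f) relations" and R' :: "('g, 'f) relations"
  assumes ideal: "\<And>p. subst p \<in> relation_ideal R \<longleftrightarrow> p \<in> relation_ideal R'"
    and S: "S \<subseteq> range (\<lambda>p. cls R (subst p))"
    and gen: "\<And>V g. subalg V (presented_algebra R) \<Longrightarrow> S \<subseteq> V \<Longrightarrow> cls R (\<theta> g) \<in> V"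
  shows "has_presentation (generated_subalg (presented_algebra R) S) (\<lambda>g. cls R (\<theta> g)) R'"
proof -
  let ?P = "presented_algebra R" and ?P' = "presented_algebra R'"
  let ?K = "range (\<lambda>p. cls R (subst p))"
  interpret P: assoc_algebra ?P by (rule assoc_algebra_presented)
  have K: "subalg ?K ?P"
  proof (rule subalg_presentedI)
    have *: "cls R u \<in> ?K \<longleftrightarrow> (\<exists>p. cls R u = cls R (subst p))" for u by auto
    show "cls R 1 \<in> ?K" using subst_one by (metis rangeI)
    show "cls R (u + v) \<in> ?K" if "cls R u \<in> ?K" "cls R v \<in> ?K" for u v
      using that unfolding * by (metis add_presented subst_add)
    show "cls R (u * v) \<in> ?K" if "cls R u \<in> ?K" "cls R v \<in> ?K" for u v
      using that unfolding * by (metis mult_presented subst_mult)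
    show "cls R (scale c u) \<in> ?K" if "cls R u \<in> ?K" for c u
      using that unfolding * by (metis smult_presented subst_scale)
  qed (auto simp: carrier_presented)
  have "cls R (subst p) \<in> V" if V: "subalg V ?P" "S \<subseteq> V" for p V
    by (induction p rule: free_alg_induct)
      (simp_all add: subst_add subst_scale subst_mult subalg_presentedD[OF V(1)] gen[OF V])
  with K S have "\<Inter>{V. subalg V ?P \<and> S \<subseteq> V} = ?K" by blast
  then have G: "generated_subalg ?P S = ?P\<lparr>carrier := ?K\<rparr>"
    by (simp add: generated_subalg_def)
  \<comment> \<open>A class is mapped through a chosen representative; by \<open>ideal\<close> the
    choice does not matter.\<close>
  define h where "h C = cls R (subst (SOME p. cls R' p = C))" for C
  have h: "h (cls R' p) = cls R (subst p)" for p
  proof -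
    have "cls R' (SOME r. cls R' r = cls R' p) = cls R' p"
      by (rule someI[of _ p]) simp
    then show ?thesis
      by (simp add: h_def cls_eq_iff flip: ideal subst_diff)
  qed
  have "h \<in> ring_hom ?P' (?P\<lparr>carrier := ?K\<rparr>)"
    by (rule ring_hom_memI)
      (auto simp: h presented_simps subst_add subst_mult simp del: cls_eq_iff)
  then have "h \<in> alg_hom ?P' (?P\<lparr>carrier := ?K\<rparr>)"
    by (auto simp: alg_hom_def h presented_simps subst_scale)
  moreover have "bij_betw h (carrier ?P') ?K"
    unfolding bij_betw_def inj_on_def carrier_presented
    by (auto simp: h cls_eq_iff image_image simp flip: ideal subst_diff)
  ultimately have "h \<in> alg_iso ?P' (?P\<lparr>carrier := ?K\<rparr>)"
    by (simp add: alg_iso_def)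
  then show ?thesis
    unfolding has_presentation_def G
    using P.assoc_algebra_subalg[OF K]
    by (auto simp: presented_gen_def h intro!: bexI[of _ h])
qed

end


text \<open>The vector stays arbitrary in the induction, because in a product \<open>p * u\<close>
  the factor \<open>p\<close> acts on \<open>act u v\<close>.\<close>

lemma (in free_action) act_relation_ideal:
  assumes R: "\<And>l r v. (l, r) \<in> R \<Longrightarrow> act l v = act r v" and "p \<in> relation_ideal R"
  shows "act p v = 0"
  using assms(2)
proof (induction arbitrary: v rule: relation_ideal_induct)
  case (mult_left u p)
  interpret Vector_Spaces.linear "(*s)" "(*s)" "act u" by (rule linear_act)
  show ?case by (simp add: act_mult mult_left zero)
qed (simp_all add: R act_diff_left act_zero_left act_add_left act_mult)

section \<open>A module with a PBW basis\<close>

lemma pm_scale_mult_left: "pm_scale c p * r = pm_scale c (p * r)"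
  and pm_scale_mult_right: "p * pm_scale c r = pm_scale c (p * r)"
  for p r :: "('g, 'f::field) free_alg"
  using scale_mult_left[of c p r] scale_mult_right[of p c r] by (simp_all add: scale_eq_pm_scale)

lemmas mult_normalize = distrib_left distrib_right left_diff_distrib right_diff_distrib
  pm_scale_mult_left pm_scale_mult_right mult.assoc pm.scale_right_distrib
  pm.scale_right_diff_distrib

type_synonym 'f pbw = "nat \<times> int \<times> nat \<Rightarrow>\<^sub>0 'f"

definition pbw :: "nat \<Rightarrow> int \<Rightarrow> nat \<Rightarrow> 'f::field pbw" where
  "pbw i j k = Poly_Mapping.single (i, j, k) 1"

text \<open>\<open>pbw i j k\<close> stands for \<open>e\<^sup>i w\<^sup>j f\<^sup>k\<close>. The truncated \<open>i - 1\<close> below is harmless, since its coefficient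
  \<open>1 - s\<^sup>i\<close> vanishes for \<open>i = 0\<close>.\<close>

locale pbw_module =
  fixes s :: "'f::field"
  assumes s_nonzero: "s \<noteq> 0"
begin

definition op_e :: "'f pbw \<Rightarrow> 'f pbw" where
  "op_e = pm.lin_ext (\<lambda>(i, j, k). pbw (Suc i) j k)"

definition op_w :: "'f pbw \<Rightarrow> 'f pbw" where
  "op_w = pm.lin_ext (\<lambda>(i, j, k). pm_scale (s ^ i) (pbw i (j + 1) k))"

definition op_y :: "'f pbw \<Rightarrow> 'f pbw" where
  "op_y = pm.lin_ext (\<lambda>(i, j, k). pm_scale (inverse (s ^ i)) (pbw i (j - 1) k))"

text \<open>The formula comes from moving \<open>f\<close> to the right: \<open>f e^i = s^i e^i f +
  (1 - s^i) (e^(i-1) - s^(i-1) e^(i-1) w^2)\<close>, followed by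
  \<open>f w^j = s^j w^j f\<close>.\<close>

definition op_f :: "'f pbw \<Rightarrow> 'f pbw" where
  "op_f = pm.lin_ext (\<lambda>(i, j, k). pm_scale (s ^ i * s powi j) (pbw i j (Suc k))
     + pm_scale (1 - s ^ i) (pbw (i - 1) j k - pm_scale (s ^ (i - 1)) (pbw (i - 1) (j + 2) k)))"

sublocale e: Vector_Spaces.linear pm_scale pm_scale op_e
  unfolding op_e_def by (rule pm.linear_lin_ext)

sublocale w: Vector_Spaces.linear pm_scale pm_scale op_w
  unfolding op_w_def by (rule pm.linear_lin_ext)

sublocale y: Vector_Spaces.linear pm_scale pm_scale op_y
  unfolding op_y_def by (rule pm.linear_lin_ext)

sublocale f: Vector_Spaces.linear pm_scale pm_scale op_f
  unfolding op_f_def by (rule pm.linear_lin_ext)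

lemma op_pbw:
  "op_e (pbw i j k) = pbw (Suc i) j k"
  "op_w (pbw i j k) = pm_scale (s ^ i) (pbw i (j + 1) k)"
  "op_y (pbw i j k) = pm_scale (inverse (s ^ i)) (pbw i (j - 1) k)"
  "op_f (pbw i j k) = pm_scale (s ^ i * s powi j) (pbw i j (Suc k))
     + pm_scale (1 - s ^ i) (pbw (i - 1) j k - pm_scale (s ^ (i - 1)) (pbw (i - 1) (j + 2) k))"
  by (simp_all add: op_e_def op_w_def op_y_def op_f_def pbw_def[of i j k])

lemma linear_eqI_pbw:
  assumes "\<And>u v. A (u + v) = A u + A v" "\<And>c u. A (pm_scale c u) = pm_scale c (A u)"
    and "\<And>u v. B (u + v) = B u + B v" "\<And>c u. B (pm_scale c u) = pm_scale c (B u)"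
    and "\<And>i j k. A (pbw i j k) = B (pbw i j k)"
  shows "A v = (B v :: 'f pbw)"
  by (rule pm.linear_eqI_single)
    (use assms in \<open>auto intro!: linear_mapI pm.vector_space_axioms simp: pbw_def\<close>)

lemmas op_linear = e.add e.scale e.diff w.add w.scale w.diff y.add y.scale y.diff f.add f.scale f.diff
  pm.scale_right_distrib pm.scale_right_diff_distrib

lemmas lookup_simps = lookup_add lookup_minus lookup_pm_scale

lemma op_w_e: "op_w (op_e v) = pm_scale s (op_e (op_w v))"
  by (rule linear_eqI_pbw[of "\<lambda>v. op_w (op_e v)"]) (simp_all add: op_linear op_pbw mult.commute)

lemma op_w_y [simp]: "op_w (op_y v) = v" and op_y_w [simp]: "op_y (op_w v) = v"
  by (rule linear_eqI_pbw[of "\<lambda>v. op_w (op_y v)"] linear_eqI_pbw[of "\<lambda>v. op_y (op_w v)"];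
      simp add: op_linear op_pbw s_nonzero)+

lemma op_f_w: "op_f (op_w v) = pm_scale s (op_w (op_f v))"
proof (rule linear_eqI_pbw[of "\<lambda>v. op_f (op_w v)"])
  show "op_f (op_w (pbw i j k)) = pm_scale s (op_w (op_f (pbw i j k)))" for i j k
    by (cases i) (simp_all add: op_linear op_pbw s_nonzero power_int_add algebra_simps)
qed (simp_all add: op_linear mult.commute)

text \<open>On a symbol with first exponent \<open>i\<close> this reduces to
  \<open>1 - s^(i+1) = s (1 - s^i) + (1 - s)\<close> and its analogue for the terms with
  \<open>w^2\<close>. The case \<open>i = 0\<close> is separate because of the truncated
  \<open>i - 1\<close>.\<close>

lemma op_f_e:
  "op_f (op_e v) = pm_scale s (op_e (op_f v)) + pm_scale (1 - s) (v - op_w (op_w v))"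
proof (rule linear_eqI_pbw[of "\<lambda>v. op_f (op_e v)"])
  show "op_f (op_e (pbw i j k)) = pm_scale s (op_e (op_f (pbw i j k)))
      + pm_scale (1 - s) (pbw i j k - op_w (op_w (pbw i j k)))" for i j k
    by (cases i; rule poly_mapping_eqI; simp add: op_linear op_pbw lookup_simps; simp add: algebra_simps)
qed (simp_all add: op_linear mult.commute algebra_simps)

text \<open>Multiplying \<open>w e = s e w\<close> by the inverse of \<open>w\<close> on both sides
  gives the rule for \<open>y\<close>; \<open>op_y_f\<close> arises likewise from
  \<open>op_f_w\<close>.\<close>

lemma op_e_y: "op_e (op_y v) = pm_scale s (op_y (op_e v))"
  using arg_cong[OF op_w_e[of "op_y v"], of op_y] by (simp add: op_linear)

lemma op_y_f: "op_y (op_f v) = pm_scale s (op_f (op_y v))"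
  using arg_cong[OF op_f_w[of "op_y v"], of op_y] by (simp add: op_linear)

end

section \<open>The action of \<open>U_q\<close> on the PBW module\<close>

locale equitable = pbw_module "inverse q ^ 2" for q :: "'f::field" +
  assumes q_nonzero: "q \<noteq> 0" and q2: "q\<^sup>2 \<noteq> 1"
begin

abbreviation s where "s \<equiv> inverse q ^ 2"

fun Uq_op :: "Uq_gen \<Rightarrow> 'f pbw \<Rightarrow> 'f pbw" where
  "Uq_op U_x v = op_e v + op_w v"
| "Uq_op U_y v = op_y v"
| "Uq_op U_yinv v = op_w v"
| "Uq_op U_z v = op_f v + op_w v"

sublocale U: free_action pm_scale Uq_op
proof (intro free_action.intro free_action_axioms.intro pm.linear_extension_axioms)
  show "Vector_Spaces.linear pm_scale pm_scale (Uq_op g)" for g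
    by (cases g) (auto intro!: linear_mapI pm.vector_space_axioms simp: op_linear algebra_simps)
qed

lemma q_diff_nonzero: "q - inverse q \<noteq> 0"
  using q_nonzero q2 by (auto simp: field_simps power2_eq_square)

lemma act_q_bracket:
  "U.act (q_bracket q (var g) (var h)) v =
     pm_scale (1 / (q - inverse q))
       (pm_scale q (Uq_op g (Uq_op h v)) - pm_scale (inverse q) (Uq_op h (Uq_op g v)))"
  by (simp add: q_bracket_def U.act_scale_left U.act_diff_left U.act_mult)

lemma act_q_bracket_eq:
  assumes "pm_scale q (Uq_op g (Uq_op h v)) - pm_scale (inverse q) (Uq_op h (Uq_op g v))
    = pm_scale (q - inverse q) v"
  shows "U.act (q_bracket q (var g) (var h)) v = v"
  unfolding act_q_bracket assms using q_diff_nonzero by simp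

text \<open>Put \<open>x = e + w\<close> and \<open>z = f + w\<close>. Since
  \<open>q s = inverse q\<close>, the mixed terms \<open>e y\<close>, \<open>y f\<close>,
  \<open>f w\<close>, \<open>w e\<close> cancel against their reversals. In the bracket of
  \<open>z\<close> and \<open>x\<close>, the part from \<open>f\<close> and \<open>e\<close> leaves
  \<open>1 - w^2\<close>, and the product of \<open>w\<close> with itself restores
  \<open>w^2\<close>.\<close>

lemma act_Uq_relations:
  assumes "(l, r) \<in> Uq_relations q"
  shows "U.act l v = U.act r v"
proof -
  have "U.act (q_bracket q (var U_x) (var U_y)) v = v"
    by (rule act_q_bracket_eq, rule poly_mapping_eqI)
      (use q_nonzero in \<open>simp add: op_linear op_e_y lookup_simps, simp add: field_simps power2_eq_square\<close>)
  moreover have "U.act (q_bracket q (var U_y) (var U_z)) v = v"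
    by (rule act_q_bracket_eq, rule poly_mapping_eqI)
      (use q_nonzero in \<open>simp add: op_linear op_y_f lookup_simps, simp add: field_simps power2_eq_square\<close>)
  moreover have "U.act (q_bracket q (var U_z) (var U_x)) v = v"
    by (rule act_q_bracket_eq, rule poly_mapping_eqI)
      (use q_nonzero in \<open>simp add: op_linear op_f_e op_w_e op_f_w lookup_simps,
        simp add: field_simps power2_eq_square\<close>)
  ultimately show ?thesis
    using assms by (auto simp: Uq_relations_def U.act_mult)
qed

end

section \<open>Straightening modulo the relations\<close>

locale straightening = pbw_module s for s :: "'f::field" +
  fixes R :: "('g, 'f) relations" and E W F :: "('g, 'f) free_alg"
  assumes W_E: "W * E - pm_scale s (E * W) \<in> relation_ideal R"
    and F_W: "F * W - pm_scale s (W * F) \<in> relation_ideal R"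
    and F_E: "F * E - (pm_scale s (E * F) + pm_scale (1 - s) (1 - W * W)) \<in> relation_ideal R"
begin

definition cong :: "('g, 'f) free_alg \<Rightarrow> ('g, 'f) free_alg \<Rightarrow> bool" (infix \<open>\<approx>\<close> 50) where
  "u \<approx> v \<longleftrightarrow> u - v \<in> relation_ideal R"

lemma cong_refl [simp]: "u \<approx> u"
  by (simp add: cong_def)

lemma cong_trans [trans]: "u \<approx> v \<Longrightarrow> v \<approx> x \<Longrightarrow> u \<approx> x"
  unfolding cong_def using relation_ideal_add[of "u - v" R "v - x"] by simp

lemma cong_sym: "u \<approx> v \<Longrightarrow> v \<approx> u"
  unfolding cong_def using relation_ideal_minus[of "u - v" R] by simp

lemma cong_add: "u \<approx> v \<Longrightarrow> u' \<approx> v' \<Longrightarrow> u + u' \<approx> v + v'"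
  unfolding cong_def using relation_ideal_add[of "u - v" R "u' - v'"] by (simp add: algebra_simps)

lemma cong_diff: "u \<approx> v \<Longrightarrow> u' \<approx> v' \<Longrightarrow> u - u' \<approx> v - v'"
  unfolding cong_def using relation_ideal_diff[of "u - v" R "u' - v'"] by (simp add: algebra_simps)

lemma cong_scale: "u \<approx> v \<Longrightarrow> pm_scale c u \<approx> pm_scale c v"
  unfolding cong_def using relation_ideal_scale[of "u - v" R c]
  by (simp add: scale_eq_pm_scale pm.scale_right_diff_distrib)

lemma cong_mult_left: "u \<approx> v \<Longrightarrow> x * u \<approx> x * v"
  unfolding cong_def using relation_ideal_mult_left[of "u - v" R x] by (simp add: algebra_simps)

lemma cong_mult_right: "u \<approx> v \<Longrightarrow> u * x \<approx> v * x"
  unfolding cong_def using relation_ideal_mult_right[of "u - v" R x] by (simp add: algebra_simps)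

lemma commute_power:
  assumes "A * B \<approx> pm_scale s (B * A)"
  shows "A * B ^ n \<approx> pm_scale (s ^ n) (B ^ n * A)"
proof (induction n)
  case (Suc n)
  have "A * B ^ Suc n = (A * B) * B ^ n" by (simp add: mult.assoc)
  also have "\<dots> \<approx> pm_scale s (B * A) * B ^ n" by (rule cong_mult_right[OF assms])
  also have "\<dots> = pm_scale s (B * (A * B ^ n))" by (simp add: mult_normalize)
  also have "\<dots> \<approx> pm_scale s (B * pm_scale (s ^ n) (B ^ n * A))"
    by (intro cong_scale cong_mult_left Suc.IH)
  also have "\<dots> = pm_scale (s ^ Suc n) (B ^ Suc n * A)" by (simp add: mult_normalize)
  finally show ?case .
qed simp

lemma W_E_power: "W * E ^ n \<approx> pm_scale (s ^ n) (E ^ n * W)"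
  and F_W_power: "F * W ^ n \<approx> pm_scale (s ^ n) (W ^ n * F)"
  using W_E F_W by (auto intro!: commute_power simp flip: cong_def)

text \<open>One factor \<open>F E\<close> is straightened, then the induction hypothesis applies and
  \<open>W * W\<close> is moved past \<open>E ^ n\<close>. The coefficients are those built into
  \<open>op_f\<close>.\<close>

lemma F_E_power:
  "F * E ^ n \<approx> pm_scale (s ^ n) (E ^ n * F)
     + pm_scale (1 - s ^ n) (E ^ (n - 1) - pm_scale (s ^ (n - 1)) (E ^ (n - 1) * (W * W)))"
proof (induction n)
  case (Suc n)
  have WW: "W * (W * E ^ n) \<approx> pm_scale (s ^ n * s ^ n) (E ^ n * (W * W))"
  proof -
    have "W * (W * E ^ n) \<approx> W * pm_scale (s ^ n) (E ^ n * W)"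
      by (rule cong_mult_left[OF W_E_power])
    also have "\<dots> = pm_scale (s ^ n) ((W * E ^ n) * W)"
      by (simp add: mult_normalize)
    also have "\<dots> \<approx> pm_scale (s ^ n) (pm_scale (s ^ n) (E ^ n * W) * W)"
      by (intro cong_scale cong_mult_right W_E_power)
    also have "\<dots> = pm_scale (s ^ n * s ^ n) (E ^ n * (W * W))"
      by (simp add: mult_normalize)
    finally show ?thesis .
  qed
  have "F * E ^ Suc n = (F * E) * E ^ n" by (simp add: mult.assoc)
  also have "\<dots> \<approx> (pm_scale s (E * F) + pm_scale (1 - s) (1 - W * W)) * E ^ n"
    using F_E by (intro cong_mult_right) (simp add: cong_def)
  also have "\<dots> = pm_scale s (E * (F * E ^ n)) + pm_scale (1 - s) (E ^ n - W * (W * E ^ n))"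
    by (simp add: mult_normalize)
  also have "\<dots> \<approx> pm_scale s (E * (pm_scale (s ^ n) (E ^ n * F)
        + pm_scale (1 - s ^ n) (E ^ (n - 1) - pm_scale (s ^ (n - 1)) (E ^ (n - 1) * (W * W)))))
      + pm_scale (1 - s) (E ^ n - pm_scale (s ^ n * s ^ n) (E ^ n * (W * W)))"
    by (intro cong_add cong_diff cong_scale cong_mult_left Suc.IH WW cong_refl)
  also have "\<dots> = pm_scale (s ^ Suc n) (E ^ Suc n * F)
      + pm_scale (1 - s ^ Suc n) (E ^ n - pm_scale (s ^ n) (E ^ n * (W * W)))"
    \<comment> \<open>For \<open>n = 0\<close> the truncated \<open>n - 1\<close> carries the factor
      \<open>1 - s ^ 0 = 0\<close>; otherwise it is a true predecessor.\<close>
    by (cases n; rule poly_mapping_eqI; simp add: mult_normalize lookup_simps; simp add: algebra_simps)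
  finally show ?case by simp
qed simp

text \<open>For negative \<open>j\<close> the exponent \<open>nat j = 0\<close> is only a
  placeholder; the reading is meaningful on symbols with \<open>j\<close> at least 0.\<close>

definition ordered :: "'f pbw \<Rightarrow> ('g, 'f) free_alg" where
  "ordered = pm.lin_ext (\<lambda>(i, j, k). E ^ i * W ^ nat j * F ^ k)"

sublocale ordered: Vector_Spaces.linear pm_scale pm_scale ordered
  unfolding ordered_def by (rule pm.linear_lin_ext)

lemma ordered_pbw [simp]: "ordered (pbw i j k) = E ^ i * (W ^ nat j * F ^ k)"
  by (simp add: ordered_def pbw_def mult.assoc)

text \<open>The operators on the module involve negative powers of \<open>w\<close>, which have no counterpart
  in the free algebra; hence the restriction to this subspace.\<close>

definition nonneg :: "'f pbw set" where
  "nonneg = pm.span {pbw i j k | i j k. 0 \<le> j}"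

lemma nonneg_pbw: "0 \<le> j \<Longrightarrow> pbw i j k \<in> nonneg"
  unfolding nonneg_def by (rule pm.span_base) blast

lemma nonneg_add: "u \<in> nonneg \<Longrightarrow> v \<in> nonneg \<Longrightarrow> u + v \<in> nonneg"
  and nonneg_diff: "u \<in> nonneg \<Longrightarrow> v \<in> nonneg \<Longrightarrow> u - v \<in> nonneg"
  and nonneg_scale: "u \<in> nonneg \<Longrightarrow> pm_scale c u \<in> nonneg"
  unfolding nonneg_def by (rule pm.span_add pm.span_diff pm.span_scale; assumption)+

text \<open>The vectors satisfying the conclusion form a subspace, so it is enough to check the
  basis symbols that span \<open>nonneg\<close>.\<close>

lemma nonneg_step:
  assumes A: "Vector_Spaces.linear pm_scale pm_scale A"
    and basis: "\<And>i j k. 0 \<le> j \<Longrightarrow>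
      A (pbw i j k) \<in> nonneg \<and> ordered (A (pbw i j k)) \<approx> P * ordered (pbw i j k)"
    and v: "v \<in> nonneg"
  shows "A v \<in> nonneg \<and> ordered (A v) \<approx> P * ordered v"
proof -
  interpret A: Vector_Spaces.linear pm_scale pm_scale A by (rule A)
  have "0 \<in> nonneg" unfolding nonneg_def by (rule pm.span_zero)
  then have "pm.subspace {v. A v \<in> nonneg \<and> ordered (A v) \<approx> P * ordered v}"
    by (auto intro!: pm.subspaceI
        simp: A.zero A.add A.scale ordered.zero ordered.add ordered.scale nonneg_add nonneg_scale
          distrib_left pm_scale_mult_right cong_add cong_scale)
  then show ?thesis
    by (rule pm.span_induct[OF v[unfolded nonneg_def]]) (use basis in auto)
qed

lemma nonneg_e: "v \<in> nonneg \<Longrightarrow> op_e v \<in> nonneg \<and> ordered (op_e v) \<approx> E * ordered v"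
  by (rule nonneg_step[OF e.linear_axioms]) (simp_all add: op_pbw nonneg_pbw mult.assoc)

lemma nonneg_w: "v \<in> nonneg \<Longrightarrow> op_w v \<in> nonneg \<and> ordered (op_w v) \<approx> W * ordered v"
proof (rule nonneg_step[OF w.linear_axioms])
  fix i k and j :: int
  assume j: "0 \<le> j"
  have "W * ordered (pbw i j k) = (W * E ^ i) * (W ^ nat j * F ^ k)"
    by (simp add: mult.assoc)
  also have "\<dots> \<approx> pm_scale (s ^ i) (E ^ i * W) * (W ^ nat j * F ^ k)"
    by (rule cong_mult_right[OF W_E_power])
  also have "\<dots> = ordered (op_w (pbw i j k))"
    using j by (simp add: op_pbw ordered.scale pm_scale_mult_left nat_add_distrib mult.assoc)
  finally have "ordered (op_w (pbw i j k)) \<approx> W * ordered (pbw i j k)"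
    by (rule cong_sym)
  then show "op_w (pbw i j k) \<in> nonneg \<and> ordered (op_w (pbw i j k)) \<approx> W * ordered (pbw i j k)"
    using j by (simp add: op_pbw nonneg_scale nonneg_pbw)
qed

text \<open>Moving \<open>F\<close> first past \<open>E ^ i\<close> and then past
  \<open>W ^ nat j\<close> reproduces the defining formula of \<open>op_f\<close> term by
  term.\<close>

lemma nonneg_f: "v \<in> nonneg \<Longrightarrow> op_f v \<in> nonneg \<and> ordered (op_f v) \<approx> F * ordered v"
proof (rule nonneg_step[OF f.linear_axioms])
  fix i k and j :: int
  assume j: "0 \<le> j"
  let ?m = "W ^ nat j * F ^ k"
  let ?t = "pm_scale (1 - s ^ i) (E ^ (i - 1) - pm_scale (s ^ (i - 1)) (E ^ (i - 1) * (W * W)))"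
  have s_powi: "s powi j = s ^ nat j"
    using j by (simp add: power_int_def)
  have nat_j: "nat (j + 2) = Suc (Suc (nat j))"
    using j by simp
  have "F * ordered (pbw i j k) = (F * E ^ i) * ?m"
    by (simp add: mult.assoc)
  also have "\<dots> \<approx> (pm_scale (s ^ i) (E ^ i * F) + ?t) * ?m"
    by (rule cong_mult_right[OF F_E_power])
  also have "\<dots> = pm_scale (s ^ i) (E ^ i * ((F * W ^ nat j) * F ^ k)) + ?t * ?m"
    by (simp add: distrib_right pm_scale_mult_left mult.assoc)
  also have "\<dots> \<approx> pm_scale (s ^ i) (E ^ i * (pm_scale (s ^ nat j) (W ^ nat j * F) * F ^ k)) + ?t * ?m"
    by (intro cong_add cong_scale cong_mult_left cong_mult_right F_W_power cong_refl)
  also have "\<dots> = ordered (op_f (pbw i j k))"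
    by (simp add: op_pbw ordered.add ordered.scale ordered.diff s_powi nat_j mult_normalize)
  finally have "ordered (op_f (pbw i j k)) \<approx> F * ordered (pbw i j k)"
    by (rule cong_sym)
  then show "op_f (pbw i j k) \<in> nonneg \<and> ordered (op_f (pbw i j k)) \<approx> F * ordered (pbw i j k)"
    using j by (simp add: op_pbw nonneg_add nonneg_diff nonneg_scale nonneg_pbw)
qed

end


section \<open>The alternative generators\<close>

locale alternative = equitable q for q :: "'f::field" +
  fixes a :: 'f
  assumes a_nonzero: "a \<noteq> 0"
begin

definition m :: 'f where
  "m = inverse q / (q - inverse q)"

text \<open>Since \<open>q / (q - q\<^sup>-\<^sup>1) = 1 + m\<close>, the bracket has coefficients that are polynomial in \<open>m\<close>, so
  that the identities below need no division.\<close>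

lemma q_bracket_eq: "q_bracket q u v = pm_scale (1 + m) (u * v) - pm_scale m (v * u)"
proof -
  have "1 / (q - inverse q) * q = 1 + m" "1 / (q - inverse q) * inverse q = m"
    using q_diff_nonzero by (simp_all add: m_def add_divide_eq_iff)
  then show ?thesis
    by (simp add: q_bracket_def scale_eq_pm_scale pm.scale_right_diff_distrib)
qed

text \<open>These identities turn a bracket multiplied by \<open>1 - s\<close> into
  \<open>u * v - pm_scale s (v * u)\<close>, the form needed for straightening.\<close>

lemma m_eq: "(1 - s) * (1 + m) = 1" "(1 - s) * m = s"
proof -
  have *: "(1 - s) * q = q - inverse q"
    using q_nonzero by (simp add: power2_eq_square field_simps)
  have "1 + m = q / (q - inverse q)"
    using q_diff_nonzero by (simp add: m_def add_divide_eq_iff)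
  then show "(1 - s) * (1 + m) = 1"
    using * q_diff_nonzero by simp
  then show "(1 - s) * m = s"
    by (simp add: algebra_simps)
qed

abbreviation \<alpha> :: 'f where "\<alpha> \<equiv> inverse (a\<^sup>2)"
abbreviation \<beta> :: 'f where "\<beta> \<equiv> a\<^sup>2"

lemma \<alpha>_\<beta> [simp]: "\<alpha> * \<beta> = 1" "\<beta> * \<alpha> = 1" "\<alpha> * (\<beta> * c) = c" "\<beta> * (\<alpha> * c) = c"
  using a_nonzero by simp_all

fun \<theta> :: "vee_gen \<Rightarrow> (Uq_gen, 'f) free_alg" where
  "\<theta> V_X = pm_scale \<alpha> (var U_x) + pm_scale (1 - \<alpha>) (var U_yinv)"
| "\<theta> V_yinv = var U_yinv"
| "\<theta> V_Z = pm_scale \<beta> (var U_z) + pm_scale (1 - \<beta>) (var U_yinv)"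

sublocale free_alg_subst \<theta> .

section \<open>The relations of the theorem hold in \<open>U_q\<close>\<close>

lemma Uq_relation_ideal:
  "var U_y * var U_yinv - 1 \<in> relation_ideal (Uq_relations q)"
  "var U_yinv * var U_y - 1 \<in> relation_ideal (Uq_relations q)"
  "q_bracket q (var U_x) (var U_y) - 1 \<in> relation_ideal (Uq_relations q)"
  "q_bracket q (var U_y) (var U_z) - 1 \<in> relation_ideal (Uq_relations q)"
  "q_bracket q (var U_z) (var U_x) - 1 \<in> relation_ideal (Uq_relations q)"
  by (auto intro!: relation_ideal_relation simp: Uq_relations_def)

lemma ideal_scale: "p \<in> relation_ideal R \<Longrightarrow> pm_scale c p \<in> relation_ideal R"
  using relation_ideal_scale[of p R c] by (simp add: scale_eq_pm_scale)

lemmas relation_ideal_intros = relation_ideal_add relation_ideal_diff ideal_scale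
  relation_ideal_mult_left relation_ideal_mult_right

text \<open>The relations between \<open>y\<close> and \<open>x\<close> or \<open>z\<close> are
  multiplied by \<open>w\<close>, the inverse of \<open>y\<close>, on both sides: this turns
  \<open>x y\<close> into \<open>w x\<close>, \<open>y x\<close> into \<open>x w\<close>, and 1 into
  \<open>w^2\<close>.\<close>

lemma q_bracket_yinv:
  fixes x y w z :: "(Uq_gen, 'f) free_alg"
  defines "x \<equiv> var U_x" and "y \<equiv> var U_y" and "w \<equiv> var U_yinv" and "z \<equiv> var U_z"
  shows "q_bracket q w x - w * w \<in> relation_ideal (Uq_relations q)"
    and "q_bracket q z w - w * w \<in> relation_ideal (Uq_relations q)"
proof -
  note I = Uq_relation_ideal[folded x_def y_def w_def z_def]
  \<comment> \<open>The last two summands account for replacing \<open>y * w\<close> and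
    \<open>w * y\<close> by 1, which is valid only modulo the ideal.\<close>
  have "q_bracket q w x - w * w = w * (q_bracket q x y - 1) * w
      - pm_scale (1 + m) (w * x * (y * w - 1)) + pm_scale m ((w * y - 1) * (x * w))"
    by (simp add: q_bracket_eq mult_normalize)
  then show "q_bracket q w x - w * w \<in> relation_ideal (Uq_relations q)"
    by (simp only:) (intro relation_ideal_intros I)
  have "q_bracket q z w - w * w = w * (q_bracket q y z - 1) * w
      - pm_scale (1 + m) ((w * y - 1) * (z * w)) + pm_scale m (w * z * (y * w - 1))"
    by (simp add: q_bracket_eq mult_normalize)
  then show "q_bracket q z w - w * w \<in> relation_ideal (Uq_relations q)"
    by (simp only:) (intro relation_ideal_intros I)
qed

lemma subst_q_bracket: "subst (q_bracket q u v) = q_bracket q (subst u) (subst v)"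
  by (simp add: q_bracket_def subst_scale subst_diff subst_mult)

lemma subst_vee_relations:
  assumes "(l, r) \<in> vee_relations q"
  shows "subst l - subst r \<in> relation_ideal (Uq_relations q)"
proof -
  define x y w z :: "(Uq_gen, 'f) free_alg"
    where "x = var U_x" and "y = var U_y" and "w = var U_yinv" and "z = var U_z"
  note defs = x_def y_def w_def z_def
  note I = Uq_relation_ideal[folded defs] q_bracket_yinv[folded defs]
  define X Z where "X = pm_scale \<alpha> x + pm_scale (1 - \<alpha>) w"
    and "Z = pm_scale \<beta> z + pm_scale (1 - \<beta>) w"
  have "q_bracket q w X - w * w = pm_scale \<alpha> (q_bracket q w x - w * w)"
    by (rule poly_mapping_eqI)
      (simp add: X_def q_bracket_eq mult_normalize lookup_simps; simp add: algebra_simps)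
  then have 1: "q_bracket q w X - w * w \<in> relation_ideal (Uq_relations q)"
    by (simp only:) (intro relation_ideal_intros I)
  have "q_bracket q Z w - w * w = pm_scale \<beta> (q_bracket q z w - w * w)"
    by (rule poly_mapping_eqI)
      (simp add: Z_def q_bracket_eq mult_normalize lookup_simps; simp add: algebra_simps)
  then have 2: "q_bracket q Z w - w * w \<in> relation_ideal (Uq_relations q)"
    by (simp only:) (intro relation_ideal_intros I)
  \<comment> \<open>Bilinear expansion, with \<open>q_bracket q w w = w * w\<close>. The total
    coefficient of \<open>w * w\<close> is \<open>1 - \<alpha> * \<beta> = 0\<close>.\<close>
  have "q_bracket q Z X - 1 = (q_bracket q z x - 1)
      + pm_scale (\<beta> * (1 - \<alpha>)) (q_bracket q z w - w * w)
      + pm_scale ((1 - \<beta>) * \<alpha>) (q_bracket q w x - w * w)"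
    by (rule poly_mapping_eqI)
      (simp add: X_def Z_def q_bracket_eq mult_normalize lookup_simps; simp add: algebra_simps)
  then have 3: "q_bracket q Z X - 1 \<in> relation_ideal (Uq_relations q)"
    by (simp only:) (intro relation_ideal_intros I)
  from assms consider
      "l = q_bracket q (var V_yinv) (var V_X)" "r = (var V_yinv)\<^sup>2"
    | "l = q_bracket q (var V_Z) (var V_yinv)" "r = (var V_yinv)\<^sup>2"
    | "l = q_bracket q (var V_Z) (var V_X)" "r = 1"
    by (auto simp: vee_relations_def)
  then show ?thesis
    by cases (use 1 2 3 in \<open>simp_all add: subst_q_bracket power2_eq_square subst_mult X_def Z_def defs\<close>)
qed

section \<open>Commutation rules in the algebra presented by the new relations\<close>

abbreviation "W \<equiv> var V_yinv :: (vee_gen, 'f) free_alg"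
definition "E = pm_scale \<beta> (var V_X - W)"
definition "F = pm_scale \<alpha> (var V_Z - W)"

sublocale straightening s "vee_relations q" E W F
proof unfold_locales
  let ?I = "relation_ideal (vee_relations q)"
  define X Z where "X = (var V_X :: (vee_gen, 'f) free_alg)" and "Z = (var V_Z :: (vee_gen, 'f) free_alg)"
  note defs = E_def F_def X_def[symmetric] Z_def[symmetric]
  have I: "q_bracket q W X - W * W \<in> ?I" "q_bracket q Z W - W * W \<in> ?I" "q_bracket q Z X - 1 \<in> ?I"
    by (auto intro!: relation_ideal_relation simp: vee_relations_def X_def Z_def power2_eq_square)
  have scaled: "pm_scale (1 - s) (q_bracket q u v) = u * v - pm_scale s (v * u)"
    for u v :: "(vee_gen, 'f) free_alg"
    by (simp add: q_bracket_eq pm.scale_right_diff_distrib m_eq)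
  have "W * E - pm_scale s (E * W) = pm_scale \<beta> (pm_scale (1 - s) (q_bracket q W X - W * W))"
    unfolding pm.scale_right_diff_distrib[of "1 - s"] scaled
    by (rule poly_mapping_eqI)
      (simp add: defs mult_normalize lookup_simps; simp add: algebra_simps)
  then show "W * E - pm_scale s (E * W) \<in> ?I"
    by (simp only:) (intro relation_ideal_intros I)
  have "F * W - pm_scale s (W * F) = pm_scale \<alpha> (pm_scale (1 - s) (q_bracket q Z W - W * W))"
    unfolding pm.scale_right_diff_distrib[of "1 - s"] scaled
    by (rule poly_mapping_eqI)
      (simp add: defs mult_normalize lookup_simps; simp add: algebra_simps)
  then show "F * W - pm_scale s (W * F) \<in> ?I"
    by (simp only:) (intro relation_ideal_intros I)
  \<comment> \<open>The scalars of \<open>E\<close> and \<open>F\<close> cancel, so the left side is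
    an expansion of \<open>(Z - W) * (X - W)\<close> and its reversal, sorted by brackets.\<close>
  have "F * E - (pm_scale s (E * F) + pm_scale (1 - s) (1 - W * W))
      = pm_scale (1 - s) (q_bracket q Z X - 1) - pm_scale (1 - s) (q_bracket q Z W - W * W)
        - pm_scale (1 - s) (q_bracket q W X - W * W)"
    unfolding pm.scale_right_diff_distrib[of "1 - s"] scaled
    by (rule poly_mapping_eqI)
      (simp add: defs mult_normalize lookup_simps; simp add: algebra_simps)
  then show "F * E - (pm_scale s (E * F) + pm_scale (1 - s) (1 - W * W)) \<in> ?I"
    by (simp only:) (intro relation_ideal_intros I)
qed

section \<open>Injectivity and the isomorphism\<close>

notation cong (infix \<open>\<approx>\<close> 50)

text \<open>As \<open>x = e + w\<close>, the image of \<open>V_X\<close> acts as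
  \<open>\<alpha> e + w\<close>, while \<open>var V_X\<close> equals \<open>\<alpha> E + W\<close>;
  the case of \<open>V_Z\<close> is parallel with \<open>\<beta>\<close> and \<open>f\<close>. So
  the rules for \<open>op_e\<close>, \<open>op_w\<close>, \<open>op_f\<close> combine.\<close>

lemma ordered_act_gen:
  assumes v: "v \<in> nonneg"
  shows "U.act (\<theta> g) v \<in> nonneg \<and> ordered (U.act (\<theta> g) v) \<approx> var g * ordered v"
proof -
  note act = U.act_left.add U.act_left.scale
  note e = nonneg_e[OF v] and w = nonneg_w[OF v] and f = nonneg_f[OF v]
  have X: "U.act (\<theta> V_X) v = pm_scale \<alpha> (op_e v) + op_w v"
    by (rule poly_mapping_eqI) (simp add: act lookup_simps; simp add: algebra_simps)
  have Z: "U.act (\<theta> V_Z) v = pm_scale \<beta> (op_f v) + op_w v"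
    by (rule poly_mapping_eqI) (simp add: act lookup_simps; simp add: algebra_simps)
  show ?thesis
  proof (cases g)
    case V_X
    have "ordered (U.act (\<theta> V_X) v) \<approx> pm_scale \<alpha> (E * ordered v) + W * ordered v"
      unfolding X ordered.add ordered.scale using e w by (intro cong_add cong_scale) auto
    also have "\<dots> = var V_X * ordered v"
      by (simp add: E_def mult_normalize)
    finally show ?thesis
      unfolding V_X X using e w by (auto intro: nonneg_add nonneg_scale)
  next
    case V_yinv
    with w show ?thesis by simp
  next
    case V_Z
    have "ordered (U.act (\<theta> V_Z) v) \<approx> pm_scale \<beta> (F * ordered v) + W * ordered v"
      unfolding Z ordered.add ordered.scale using f w by (intro cong_add cong_scale) auto
    also have "\<dots> = var V_Z * ordered v"
      by (simp add: F_def mult_normalize)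
    finally show ?thesis
      unfolding V_Z Z using f w by (auto intro: nonneg_add nonneg_scale)
  qed
qed

text \<open>The induction starts at \<open>pbw 0 0 0\<close>, which is read as 1, and each further
  letter is transported by \<open>ordered_act_gen\<close>. Acting and then reading thus inverts
  \<open>subst\<close> modulo the relations.\<close>

lemma ordered_act_subst:
  "U.act (subst p) (pbw 0 0 0) \<in> nonneg \<and> ordered (U.act (subst p) (pbw 0 0 0)) \<approx> p"
proof (induction p rule: free_alg_induct)
  case one
  then show ?case by (simp add: nonneg_pbw)
next
  case (add p r)
  then show ?case
    by (simp add: subst_add U.act_left.add ordered.add nonneg_add cong_add)
next
  case (scale c p)
  then show ?case
    by (simp add: scale_eq_pm_scale subst_scale[unfolded scale_eq_pm_scale] U.act_left.scale
        ordered.scale nonneg_scale cong_scale)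
next
  case (var_mult g p)
  let ?v = "U.act (subst p) (pbw 0 0 0)"
  have "ordered (U.act (\<theta> g) ?v) \<approx> var g * ordered ?v"
    using ordered_act_gen var_mult by blast
  also have "\<dots> \<approx> var g * p"
    using var_mult by (blast intro: cong_mult_left)
  finally show ?case
    using ordered_act_gen var_mult by (simp add: subst_var_mult U.act_mult)
qed

text \<open>If \<open>subst p\<close> lies in the ideal, it acts as zero, and reading the result
  gives \<open>0 \<approx> p\<close>. The converse is the validity of the new relations in
  \<open>U_q\<close>.\<close>

lemma subst_mem_iff:
  "subst p \<in> relation_ideal (Uq_relations q) \<longleftrightarrow> p \<in> relation_ideal (vee_relations q)"
proof
  assume "subst p \<in> relation_ideal (Uq_relations q)"
  then have "U.act (subst p) (pbw 0 0 0) = 0"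
    using U.act_relation_ideal[OF act_Uq_relations] by blast
  then have "0 \<approx> p"
    using ordered_act_subst[of p] by (simp add: ordered.zero)
  then show "p \<in> relation_ideal (vee_relations q)"
    using cong_sym[of 0 p] by (simp add: cong_def)
qed (use subst_relation_ideal[OF subst_vee_relations] in blast)

lemma vee_elem_eq_cls: "vee_elem q a g = cls (Uq_relations q) (\<theta> g)"
  by (cases g) (simp_all add: X_elem_def Z_elem_def Uq_def Uq_elem_def presented_gen_def
      presented_simps scale_eq_pm_scale)

lemma has_presentation_Uq_vee: "has_presentation (Uq_vee q) (vee_elem q a) (vee_relations q)"
proof -
  let ?R = "Uq_relations q"
  let ?S = "{cls ?R (var U_x), cls ?R (var U_yinv), cls ?R (var U_z)}"
  \<comment> \<open>The defining formulas of \<open>X\<close> and \<open>Z\<close> are inverted by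
    exchanging \<open>\<alpha>\<close> and \<open>\<beta>\<close>, since
    \<open>\<alpha> * \<beta> = 1\<close>.\<close>
  have "var U_x = subst (scale \<beta> (var V_X) + scale (1 - \<beta>) (var V_yinv))"
    "var U_z = subst (scale \<alpha> (var V_Z) + scale (1 - \<alpha>) (var V_yinv))"
    by (rule poly_mapping_eqI,
        simp add: subst_add subst_scale; simp add: scale_eq_pm_scale lookup_simps; simp add: algebra_simps)+
  moreover have "var U_yinv = subst (var V_yinv)" by simp
  ultimately have S: "?S \<subseteq> range (\<lambda>p. cls ?R (subst p))"
    by (metis (no_types, lifting) empty_subsetI insert_subset rangeI)
  have "cls ?R (\<theta> g) \<in> V" if "subalg V (presented_algebra ?R)" "?S \<subseteq> V" for V g
    using that(2)
    by (cases g) (auto intro!: subalg_presentedD[OF that(1)] simp flip: scale_eq_pm_scale)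
  from has_presentation_generated_subalg[OF subst_mem_iff S this]
  show ?thesis
    by (simp add: Uq_vee_def Uq_def Uq_elem_def presented_gen_def vee_elem_eq_cls[abs_def])
qed

end

theorem theorem10p17:
  fixes q a :: "'f::field"
  assumes "q \<noteq> 0" and "q ^ 4 \<noteq> 1" and "a \<noteq> 0" and "a\<^sup>2 \<noteq> 1"
  shows "has_presentation (Uq_vee q) (vee_elem q a) (vee_relations q)"
proof -
  have "q\<^sup>2 \<noteq> 1"
    using \<open>q ^ 4 \<noteq> 1\<close> by (metis one_power2 power2_eq_square power4_eq_xxxx mult.assoc)
  then interpret alternative q a
    by unfold_locales (use assms in simp_all)
  show ?thesis by (rule has_presentation_Uq_vee)
qed

end
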